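(* Let $f\in L^2_s(\partial\mathbb B)$ be such that $f*f=f$. Then on each sphere $e^{t\mathbb S}=\{e^{tI}:I\in\mathbb S\}\subseteq\partial\mathbb B$ ($t\in\mathbb R$) one of the following holds: the restriction $f|_{e^{t\mathbb S}}$ is constant equal to $0$; or it is constant equal to $1$; or there exist $J=J(t),K=K(t)\in\mathbb S$, $J\neq K$, such that $$f(e^{tI})=-\big((J-K)^{-1}K+I(J-K)^{-1}\big)$$ for every $e^{tI}\in e^{t\mathbb S}$ (i.e. for every $I\in\mathbb S$). Moreover, if $f$ also satisfies $\widetilde f^{\,c}=f$, then (in the last case) $K=-J$.
   Context: $\mathbb H$ is the skew field of quaternions, $\mathbb B=\{q\in\mathbb H:|q|<1\}$, $\mathbb S=\{q\in\mathbb H: q^2=-1\}$, and $\partial\mathbb B=\{e^{tI}: t\in\mathbb R, I\in\mathbb S\}$, where $e^{tI}=\cos t+I\sin t$. It carries the measure $d\Sigma(e^{tI})=d\sigma(I)\,dt$, with $dt$ Lebesgue measure and $\sigma$ the area measure on $\mathbb S$, normalized so that $\sigma(\mathbb S)=\Sigma(\partial\mathbb B)=1$. A function $f:\partial\mathbb B\to\mathbb H$ is a slice function if for all $J\ne K$ in $\mathbb S$ and all $x+yI\in\partial\mathbb B$ ($x,y\in\mathbb R$, $I\in\mathbb S$), $f(x+yI)=\big((J-K)^{-1}J+I(J-K)^{-1}\big)f(x+yJ)-\big((J-K)^{-1}K+I(J-K)^{-1}\big)f(x+yK)$. $L^2_s(\partial\mathbb B)$ is the space of slice functions with $\int_{\partial\mathbb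 B}|f|^2\,d\Sigma<\infty$ (functions equal $\Sigma$-a.e. are identified); it consists exactly of the $f(q)=\sum_{n\in\mathbb Z}q^na_n$ ($\Sigma$-a.e.) with $\{a_n\}\in\ell^2(\mathbb Z,\mathbb H)$. For slice functions $f,g$ the $*$-product is $f*g(q)=0$ if $f(q)=0$ and $f*g(q)=f(q)\,g(f(q)^{-1}qf(q))$ if $f(q)\neq0$; in terms of expansions, $\sum q^na_n*\sum q^nb_n=\sum_n q^n\sum_k a_kb_{n-k}$. The conjugate of $f(q)=\sum q^na_n$ is $f^c(q)=\sum q^n\overline{a_n}$; pointwise, writing a slice function on the sphere $e^{t\mathbb S}$ as $f(e^{tI})=\alpha+I\beta$ with $\alpha,\beta\in\mathbb H$ independent of $I$, one has $f^c(e^{tI})=\overline\alpha+I\overline\beta$. Also $\widetilde f(q)=f(\bar q)$ and $\widetilde f^{\,c}=(\widetilde f)^c$. In this statement $f$ is represented by an everywhere defined slice function on $\partial\mathbb B$, and the identities $f*f=f$ and $\widetilde f^{\,c}=f$ are understood to hold at every point of $\partial\mathbb B$. *)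

theory Defs
  imports "HOL-Analysis.Analysis"
begin

section \<open>Quaternions\<close>

datatype quat = Quat (qRe: real) (qIm1: real) (qIm2: real) (qIm3: real)

lemma quat_eq_iff:
  "p = q \<longleftrightarrow> qRe p = qRe q \<and> qIm1 p = qIm1 q \<and> qIm2 p = qIm2 q \<and> qIm3 p = qIm3 q"
  by (cases p; cases q) simp

instantiation quat :: real_vector
begin

definition "0 = Quat 0 0 0 0"
definition "p + q = Quat (qRe p + qRe q) (qIm1 p + qIm1 q) (qIm2 p + qIm2 q) (qIm3 p + qIm3 q)"
definition "p - q = Quat (qRe p - qRe q) (qIm1 p - qIm1 q) (qIm2 p - qIm2 q) (qIm3 p - qIm3 q)"
definition "- p = Quat (- qRe p) (- qIm1 p) (- qIm2 p) (- qIm3 p)"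
definition "r *\<^sub>R p = Quat (r * qRe p) (r * qIm1 p) (r * qIm2 p) (r * qIm3 p)"

instance
  by standard
    (simp_all add: quat_eq_iff zero_quat_def plus_quat_def minus_quat_def uminus_quat_def
      scaleR_quat_def algebra_simps)

end

instantiation quat :: real_inner
begin

definition "inner p q = qRe p * qRe q + qIm1 p * qIm1 q + qIm2 p * qIm2 q + qIm3 p * qIm3 q"
definition "norm p = sqrt ((qRe p)\<^sup>2 + (qIm1 p)\<^sup>2 + (qIm2 p)\<^sup>2 + (qIm3 p)\<^sup>2)"
definition "sgn p = p /\<^sub>R norm (p :: quat)"
definition "dist p q = norm (p - q :: quat)"
definition [code del]:
  "(uniformity :: (quat \<times> quat) filter) = (INF e\<in>{0 <..}. principal {(x, y). dist x y < e})"
definition [code del]: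
  "open (U :: quat set) \<longleftrightarrow> (\<forall>x\<in>U. eventually (\<lambda>(x', y). x' = x \<longrightarrow> y \<in> U) uniformity)"

instance
proof
  fix x y z :: quat and r :: real
  show "inner x y = inner y x"
    by (simp add: inner_quat_def mult.commute)
  show "inner (x + y) z = inner x z + inner y z"
    by (simp add: inner_quat_def plus_quat_def algebra_simps)
  show "inner (r *\<^sub>R x) y = r * inner x y"
    by (simp add: inner_quat_def scaleR_quat_def algebra_simps)
  show "0 \<le> inner x x"
    by (simp add: inner_quat_def)
  have "inner x x = (qRe x)\<^sup>2 + (qIm1 x)\<^sup>2 + ((qIm2 x)\<^sup>2 + (qIm3 x)\<^sup>2)"
    by (simp add: inner_quat_def power2_eq_square)
  then show "inner x x = 0 \<longleftrightarrow> x = 0"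
    by (simp add: add_nonneg_eq_0_iff quat_eq_iff zero_quat_def)
  show "norm x = sqrt (inner x x)"
    by (simp add: norm_quat_def inner_quat_def power2_eq_square)
qed (rule sgn_quat_def dist_quat_def uniformity_quat_def open_quat_def)+

end

instantiation quat :: euclidean_space
begin

definition "Basis = {Quat 1 0 0 0, Quat 0 1 0 0, Quat 0 0 1 0, Quat 0 0 0 1}"

instance
proof
  fix u v x :: quat
  show "(Basis :: quat set) \<noteq> {}" "finite (Basis :: quat set)"
    by (simp_all add: Basis_quat_def)
  show "inner u v = (if u = v then 1 else 0)" if "u \<in> Basis" "v \<in> Basis"
    using that unfolding Basis_quat_def by (elim insertE emptyE) (simp_all add: inner_quat_def)
  show "(\<forall>u\<in>Basis. inner x u = 0) \<longleftrightarrow> x = 0"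
    unfolding Basis_quat_def by (cases x) (simp add: inner_quat_def zero_quat_def)
qed

end

instantiation quat :: real_normed_div_algebra
begin

definition "1 = Quat 1 0 0 0"
definition "p * q = Quat
  (qRe p * qRe q - qIm1 p * qIm1 q - qIm2 p * qIm2 q - qIm3 p * qIm3 q)
  (qRe p * qIm1 q + qIm1 p * qRe q + qIm2 p * qIm3 q - qIm3 p * qIm2 q)
  (qRe p * qIm2 q - qIm1 p * qIm3 q + qIm2 p * qRe q + qIm3 p * qIm1 q)
  (qRe p * qIm3 q + qIm1 p * qIm2 q - qIm2 p * qIm1 q + qIm3 p * qRe q)"
definition "inverse p = Quat (qRe p) (- qIm1 p) (- qIm2 p) (- qIm3 p) /\<^sub>R (norm p)\<^sup>2"
definition "p div q = p * inverse (q :: quat)"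

instance
proof
  fix x y z :: quat and r :: real
  have norm2: "(norm p)\<^sup>2 = (qRe p)\<^sup>2 + (qIm1 p)\<^sup>2 + (qIm2 p)\<^sup>2 + (qIm3 p)\<^sup>2" for p :: quat
    by (simp add: norm_quat_def)
  show "(0::quat) \<noteq> 1"
    by (simp add: zero_quat_def one_quat_def)
  have "(norm (x * y))\<^sup>2 = (norm x * norm y)\<^sup>2"
    unfolding norm2 power_mult_distrib by (simp add: times_quat_def) algebra
  then show "norm (x * y) = norm x * norm y"
    by simp
  have n: "qRe x * qRe x + qIm1 x * qIm1 x + qIm2 x * qIm2 x + qIm3 x * qIm3 x = (norm x)\<^sup>2"
    unfolding norm2 by (simp add: power2_eq_square)
  show "inverse x * x = 1" "x * inverse x = 1" if "x \<noteq> 0"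
  proof -
    define d where "d = inverse ((norm x)\<^sup>2)"
    have d: "d * (qRe x * qRe x + qIm1 x * qIm1 x + qIm2 x * qIm2 x + qIm3 x * qIm3 x) = 1"
      using that by (simp add: d_def n)
    show "inverse x * x = 1" "x * inverse x = 1"
      using d unfolding inverse_quat_def d_def[symmetric]
      by (auto simp: times_quat_def one_quat_def scaleR_quat_def algebra_simps)
  qed
  show "x * y * z = x * (y * z)"
    unfolding times_quat_def quat.sel quat.inject by (intro conjI; algebra)
  show "1 * x = x" "x * 1 = x"
    by (simp_all add: quat_eq_iff times_quat_def one_quat_def)
  show "(x + y) * z = x * z + y * z" "x * (y + z) = x * y + x * z"
    by (simp_all add: times_quat_def plus_quat_def algebra_simps)
  show "r *\<^sub>R x * y = r *\<^sub>R (x * y)" "x * r *\<^sub>R y = r *\<^sub>R (x * y)"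
    by (simp_all add: times_quat_def scaleR_quat_def algebra_simps)
  show "x div y = x * inverse y"
    by (rule divide_quat_def)
  show "inverse (0 :: quat) = 0"
    by (simp add: inverse_quat_def zero_quat_def scaleR_quat_def)
qed

end

definition qcnj :: "quat \<Rightarrow> quat" where
  "qcnj q = Quat (qRe q) (- qIm1 q) (- qIm2 q) (- qIm3 q)"


lemma quat_sel_simps [simp]:
  "qRe 0 = 0" "qIm1 0 = 0" "qIm2 0 = 0" "qIm3 0 = 0"
  "qRe 1 = 1" "qIm1 1 = 0" "qIm2 1 = 0" "qIm3 1 = 0"
  "qRe (p + q) = qRe p + qRe q" "qIm1 (p + q) = qIm1 p + qIm1 q"
  "qIm2 (p + q) = qIm2 p + qIm2 q" "qIm3 (p + q) = qIm3 p + qIm3 q"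
  "qRe (p - q) = qRe p - qRe q" "qIm1 (p - q) = qIm1 p - qIm1 q"
  "qIm2 (p - q) = qIm2 p - qIm2 q" "qIm3 (p - q) = qIm3 p - qIm3 q"
  "qRe (- p) = - qRe p" "qIm1 (- p) = - qIm1 p" "qIm2 (- p) = - qIm2 p" "qIm3 (- p) = - qIm3 p"
  "qRe (r *\<^sub>R p) = r * qRe p" "qIm1 (r *\<^sub>R p) = r * qIm1 p"
  "qIm2 (r *\<^sub>R p) = r * qIm2 p" "qIm3 (r *\<^sub>R p) = r * qIm3 p"
  "qRe (of_real r) = r" "qIm1 (of_real r) = 0" "qIm2 (of_real r) = 0" "qIm3 (of_real r) = 0"
  "qRe (qcnj p) = qRe p" "qIm1 (qcnj p) = - qIm1 p" "qIm2 (qcnj p) = - qIm2 p" "qIm3 (qcnj p) = - qIm3 p"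
  by (simp_all add: zero_quat_def one_quat_def plus_quat_def minus_quat_def uminus_quat_def
      scaleR_quat_def of_real_def qcnj_def)

lemma quat_sel_times:
  "qRe (p * q) = qRe p * qRe q - qIm1 p * qIm1 q - qIm2 p * qIm2 q - qIm3 p * qIm3 q"
  "qIm1 (p * q) = qRe p * qIm1 q + qIm1 p * qRe q + qIm2 p * qIm3 q - qIm3 p * qIm2 q"
  "qIm2 (p * q) = qRe p * qIm2 q - qIm1 p * qIm3 q + qIm2 p * qRe q + qIm3 p * qIm1 q"
  "qIm3 (p * q) = qRe p * qIm3 q + qIm1 p * qIm2 q - qIm2 p * qIm1 q + qIm3 p * qRe q"
  by (simp_all add: times_quat_def)

lemma qcnj_simps [simp]: "qcnj (qcnj p) = p" "qcnj (- p) = - qcnj p" "qcnj 0 = 0"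
  by (simp_all add: quat_eq_iff)


section \<open>The unit sphere and its measure\<close>

definition imag_units :: "quat set" (\<open>\<SS>\<close>) where
  "\<SS> = {q. q\<^sup>2 = -1}"

definition qcis :: "real \<Rightarrow> quat \<Rightarrow> quat" where
  "qcis t I = of_real (cos t) + of_real (sin t) * I"

definition bdry_ball :: "quat set" (\<open>\<partial>\<BB>\<close>) where
  "\<partial>\<BB> = {qcis t I | t I. I \<in> \<SS>}"

definition spherical :: "real \<times> real \<Rightarrow> quat" where
  "spherical = (\<lambda>(\<theta>, \<phi>). Quat 0 (sin \<theta> * cos \<phi>) (sin \<theta> * sin \<phi>) (cos \<theta>))"

text \<open>
  In spherical coordinates \<open>0 \<le> \<theta> \<le> \<pi>\<close>, \<open>0 \<le> \<phi> \<le> 2\<pi>\<close> the area element of the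
  two-sphere is \<open>sin \<theta> d\<theta> d\<phi>\<close>, with total area \<open>4\<pi>\<close>.
\<close>

definition area_measure :: "quat measure" where
  "area_measure =
     distr (density lborel (\<lambda>(\<theta>, \<phi>). ennreal (indicator ({0..pi} \<times> {0..2*pi}) (\<theta>, \<phi>) * sin \<theta> / (4 * pi))))
       borel spherical"

text \<open>
  The map \<open>(t, I) \<mapsto> qcis t I\<close> on \<open>[0, 2\<pi>] \<times> \<SS>\<close> covers the boundary twice; since
  \<open>qcis (2\<pi> - t) (- I) = qcis t I\<close> and the area measure is symmetric, the normalized
  image is the same as that of \<open>[0, \<pi>] \<times> \<SS>\<close>.  The measure lives on the Borel sets of
  all quaternions and is concentrated on the boundary.
\<close>

definition bdry_measure :: "quat measure" where
  "bdry_measure =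
     distr (uniform_measure lborel {0..2*pi} \<Otimes>\<^sub>M area_measure) borel (\<lambda>(t, I). qcis t I)"


section \<open>Slice functions\<close>

definition slice_function :: "(quat \<Rightarrow> quat) \<Rightarrow> bool" where
  "slice_function f \<longleftrightarrow>
     (\<forall>J\<in>\<SS>. \<forall>K\<in>\<SS>. J \<noteq> K \<longrightarrow>
       (\<forall>x y :: real. \<forall>I\<in>\<SS>. of_real x + of_real y * I \<in> \<partial>\<BB> \<longrightarrow>
         f (of_real x + of_real y * I) =
           (inverse (J - K) * J + I * inverse (J - K)) * f (of_real x + of_real y * J)
           - (inverse (J - K) * K + I * inverse (J - K)) * f (of_real x + of_real y * K)))"

text \<open>
  The representatives of the elements of \<open>L\<^sup>2\<^sub>s\<close>: functions are total on the quaternions,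
  but only their values on the boundary matter.  Measurability is with respect to the
  completed measure, so that it is insensitive to changes on null sets.
\<close>

definition L2_slice :: "(quat \<Rightarrow> quat) set" where
  "L2_slice = {f. slice_function f \<and> f \<in> borel_measurable (completion bdry_measure) \<and>
     integrable (completion bdry_measure) (\<lambda>q. (norm (f q))\<^sup>2)}"

definition star_prod :: "(quat \<Rightarrow> quat) \<Rightarrow> (quat \<Rightarrow> quat) \<Rightarrow> quat \<Rightarrow> quat" (infixl \<open>\<star>\<close> 70) where
  "(f \<star> g) q = (if f q = 0 then 0 else f q * g (inverse (f q) * q * f q))"

definition tilde :: "(quat \<Rightarrow> quat) \<Rightarrow> quat \<Rightarrow> quat" where
  "tilde f q = f (qcnj q)"

text \<open>
  Writing \<open>f (qcis t I) = \<alpha> + I * \<beta>\<close> for all \<open>I \<in> \<SS>\<close>, the conjugate takes the value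
  \<open>qcnj \<alpha> + I * qcnj \<beta>\<close> at \<open>qcis t I\<close>.  The lemma \<open>slice_conj_qcis\<close> below shows that this value
  is independent of the representation \<open>q = qcis t I\<close>.
\<close>

definition slice_conj :: "(quat \<Rightarrow> quat) \<Rightarrow> quat \<Rightarrow> quat" where
  "slice_conj f q = (THE p. \<exists>t I \<alpha> \<beta>. I \<in> \<SS> \<and> q = qcis t I \<and>
     (\<forall>I'\<in>\<SS>. f (qcis t I') = \<alpha> + I' * \<beta>) \<and> p = qcnj \<alpha> + I * qcnj \<beta>)"


section \<open>Consistency of the definitions\<close>

lemma imag_units_iff:
  "q \<in> \<SS> \<longleftrightarrow> qRe q = 0 \<and> (qIm1 q)\<^sup>2 + (qIm2 q)\<^sup>2 + (qIm3 q)\<^sup>2 = 1"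
proof
  assume "q \<in> \<SS>"
  then have h: "qRe q * qRe q - qIm1 q * qIm1 q - qIm2 q * qIm2 q - qIm3 q * qIm3 q = -1"
    "qRe q * qIm1 q = 0" "qRe q * qIm2 q = 0" "qRe q * qIm3 q = 0"
    by (auto simp: imag_units_def power2_eq_square quat_eq_iff quat_sel_times)
  have "qRe q = 0"
  proof (rule ccontr)
    assume "qRe q \<noteq> 0"
    then have "qRe q * qRe q = -1"
      using h by simp
    moreover have "qRe q * qRe q \<ge> 0"
      by simp
    ultimately show False
      by linarith
  qed
  with h show "qRe q = 0 \<and> (qIm1 q)\<^sup>2 + (qIm2 q)\<^sup>2 + (qIm3 q)\<^sup>2 = 1"
    by (simp add: power2_eq_square)
qed (auto simp: imag_units_def power2_eq_square quat_eq_iff quat_sel_times)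

lemma imag_units_uminus: "I \<in> \<SS> \<Longrightarrow> - I \<in> \<SS>"
  by (simp add: imag_units_def)

lemma bdry_ball_eq_sphere: "\<partial>\<BB> = sphere 0 1"
proof (intro set_eqI iffI)
  fix q assume "q \<in> \<partial>\<BB>"
  then obtain t I where q: "q = qcis t I" "I \<in> \<SS>"
    by (auto simp: bdry_ball_def)
  have "(cos t)\<^sup>2 + (sin t * qIm1 I)\<^sup>2 + (sin t * qIm2 I)\<^sup>2 + (sin t * qIm3 I)\<^sup>2
      = (cos t)\<^sup>2 + (sin t)\<^sup>2 * ((qIm1 I)\<^sup>2 + (qIm2 I)\<^sup>2 + (qIm3 I)\<^sup>2)"
    by (simp add: power_mult_distrib algebra_simps)
  also have "\<dots> = 1"
    using q(2) by (simp add: imag_units_iff)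
  finally show "q \<in> sphere 0 1"
    using q by (simp add: norm_quat_def qcis_def quat_sel_times imag_units_iff)
next
  fix q :: quat assume "q \<in> sphere 0 1"
  then have n: "(qRe q)\<^sup>2 + (qIm1 q)\<^sup>2 + (qIm2 q)\<^sup>2 + (qIm3 q)\<^sup>2 = 1"
    by (simp add: norm_quat_def)
  define s where "s = sqrt ((qIm1 q)\<^sup>2 + (qIm2 q)\<^sup>2 + (qIm3 q)\<^sup>2)"
  have s2: "s\<^sup>2 = (qIm1 q)\<^sup>2 + (qIm2 q)\<^sup>2 + (qIm3 q)\<^sup>2"
    by (simp add: s_def)
  have "(qRe q)\<^sup>2 + s\<^sup>2 = 1"
    using n s2 by simp
  then obtain t where t: "qRe q = cos t" "s = sin t"
    using sincos_total_2pi by metis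
  show "q \<in> \<partial>\<BB>"
  proof (cases "s = 0")
    case True
    have "q = qcis t (Quat 0 1 0 0)"
      using True s2 t by (simp add: quat_eq_iff qcis_def quat_sel_times add_nonneg_eq_0_iff)
    moreover have "Quat 0 1 0 0 \<in> \<SS>"
      by (simp add: imag_units_iff)
    ultimately show ?thesis
      by (auto simp: bdry_ball_def)
  next
    case False
    define I where "I = Quat 0 (qIm1 q / s) (qIm2 q / s) (qIm3 q / s)"
    have "I \<in> \<SS>"
    proof -
      have "(qIm1 q / s)\<^sup>2 + (qIm2 q / s)\<^sup>2 + (qIm3 q / s)\<^sup>2 = s\<^sup>2 / s\<^sup>2"
        unfolding s2 power_divide add_divide_distrib ..
      then show ?thesis
        using False by (simp add: I_def imag_units_iff)
    qed
    moreover have "q = qcis t I"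
      using False t by (simp add: quat_eq_iff qcis_def quat_sel_times I_def)
    ultimately show ?thesis
      by (auto simp: bdry_ball_def)
  qed
qed

lemma quat_decomp:
  "Quat a b c d = a *\<^sub>R Quat 1 0 0 0 + b *\<^sub>R Quat 0 1 0 0 + c *\<^sub>R Quat 0 0 1 0 + d *\<^sub>R Quat 0 0 0 1"
  by (simp add: quat_eq_iff)

lemma borel_measurable_spherical [measurable]: "spherical \<in> borel_measurable borel"
  unfolding spherical_def case_prod_unfold
  by (subst quat_decomp) (intro borel_measurable_continuous_onI continuous_intros)

lemma borel_measurable_qcis [measurable]: "(\<lambda>(t, I). qcis t I) \<in> borel_measurable borel"
  unfolding qcis_def case_prod_unfold
  by (intro borel_measurable_continuous_onI continuous_intros)

lemma spherical_in_imag_units: "spherical x \<in> \<SS>"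
proof -
  obtain \<theta> \<phi> where x: "x = (\<theta>, \<phi>)"
    by (cases x)
  have "(sin \<theta> * cos \<phi>)\<^sup>2 + (sin \<theta> * sin \<phi>)\<^sup>2 + (cos \<theta>)\<^sup>2
      = (sin \<theta>)\<^sup>2 * ((sin \<phi>)\<^sup>2 + (cos \<phi>)\<^sup>2) + (cos \<theta>)\<^sup>2"
    by (simp only: power_mult_distrib algebra_simps)
  then show ?thesis
    by (simp add: imag_units_iff spherical_def x)
qed

lemma closed_imag_units: "closed \<SS>"
proof -
  have "\<SS> = (\<lambda>q. q\<^sup>2) -` {-1}"
    by (auto simp: imag_units_def)
  moreover have "closed \<dots>"
    by (intro closed_vimage closed_singleton continuous_intros)
  ultimately show ?thesis by simp
qed

lemma emeasure_area_measure_imag_units: "emeasure area_measure \<SS> = 1"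
  and emeasure_area_measure_UNIV: "emeasure area_measure UNIV = 1"
proof -
  let ?g = "\<lambda>(\<theta>, \<phi>). ennreal (indicator ({0..pi} \<times> {0..2*pi}) (\<theta>, \<phi>) * sin \<theta> / (4 * pi))"
  have meas: "?g \<in> borel_measurable (borel :: (real \<times> real) measure)"
    unfolding borel_prod[symmetric] by measurable
  have nn: "(\<integral>\<^sup>+ \<theta>. ennreal (indicator {0..pi} \<theta> * sin \<theta>) \<partial>lborel) = 2"
  proof -
    have "(\<integral>\<^sup>+ \<theta>. ennreal (sin \<theta>) * indicator {0..pi} \<theta> \<partial>lborel) = ennreal (- cos pi - (- cos 0))"
      by (rule nn_integral_FTC_Icc) (auto intro!: derivative_eq_intros sin_ge_zero
          simp: has_real_derivative_iff_has_vector_derivative[symmetric])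
    moreover have "ennreal (sin \<theta>) * indicator {0..pi} \<theta> = ennreal (indicator {0..pi} \<theta> * sin \<theta>)" for \<theta>
      by (simp split: split_indicator)
    ultimately show ?thesis by simp
  qed
  have "(\<integral>\<^sup>+ x. ?g x \<partial>lborel) = (\<integral>\<^sup>+ \<theta>. (\<integral>\<^sup>+ \<phi>. ?g (\<theta>, \<phi>) \<partial>lborel) \<partial>lborel)"
    using meas by (subst lborel_prod[symmetric], subst lborel.nn_integral_fst)
      (simp_all add: lborel_prod)
  also have "\<dots> = (\<integral>\<^sup>+ \<theta>. ennreal (indicator {0..pi} \<theta> * sin \<theta>) * ennreal (1/2) \<partial>lborel)"
  proof (intro nn_integral_cong)
    fix \<theta> :: real
    have "(\<integral>\<^sup>+ \<phi>. ?g (\<theta>, \<phi>) \<partial>lborel)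
        = (\<integral>\<^sup>+ \<phi>. ennreal (indicator {0..pi} \<theta> * sin \<theta> / (4 * pi)) * indicator {0..2*pi} \<phi> \<partial>lborel)"
      by (intro nn_integral_cong) (auto split: split_indicator)
    also have "\<dots> = ennreal (indicator {0..pi} \<theta> * sin \<theta> / (4 * pi)) * ennreal (2 * pi)"
      by (simp add: nn_integral_cmult)
    also have "\<dots> = ennreal (indicator {0..pi} \<theta> * sin \<theta>) * ennreal (1/2)"
      using ennreal_mult''[of "2 * pi" "indicator {0..pi} \<theta> * sin \<theta> / (4 * pi)"]
        ennreal_mult''[of "1/2" "indicator {0..pi} \<theta> * sin \<theta>"] pi_gt_zero
      by (simp add: field_simps)
    finally show "(\<integral>\<^sup>+ \<phi>. ?g (\<theta>, \<phi>) \<partial>lborel) = ennreal (indicator {0..pi} \<theta> * sin \<theta>) * ennreal (1/2)" .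
  qed
  also have "\<dots> = 2 * ennreal (1/2)"
    by (subst nn_integral_multc) (simp_all add: nn)
  also have "\<dots> = 1"
    by (metis ennreal_1 ennreal_mult' ennreal_numeral mult.commute nonzero_eq_divide_eq
        zero_le_numeral zero_neq_numeral)
  finally have one: "(\<integral>\<^sup>+ x. ?g x \<partial>lborel) = 1" .
  have "spherical -` \<SS> = UNIV"
    using spherical_in_imag_units by auto
  then show "emeasure area_measure \<SS> = 1" "emeasure area_measure UNIV = 1"
    using one meas closed_imag_units
    by (simp_all add: area_measure_def emeasure_distr emeasure_density borel_closed)
qed

lemma emeasure_bdry_measure_bdry_ball: "emeasure bdry_measure \<partial>\<BB> = 1"
  and emeasure_bdry_measure_UNIV: "emeasure bdry_measure UNIV = 1"
proof -
  let ?U = "uniform_measure lborel {0..2*pi}"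
  let ?P = "?U \<Otimes>\<^sub>M area_measure"
  interpret A: finite_measure area_measure
    by standard (simp add: area_measure_def emeasure_area_measure_UNIV[unfolded area_measure_def])
  have U1: "emeasure ?U UNIV = 1"
    by (subst emeasure_uniform_measure) (simp_all add: ennreal_divide_self)
  have S: "\<SS> \<in> sets area_measure"
    by (simp add: area_measure_def borel_closed closed_imag_units)
  have B: "\<partial>\<BB> \<in> sets borel"
    by (simp add: bdry_ball_eq_sphere borel_closed)
  have sp: "space ?P = UNIV"
    by (simp add: space_pair_measure area_measure_def)
  have "sets ?P = sets (borel \<Otimes>\<^sub>M borel)"
    by (intro sets_pair_measure_cong) (simp_all add: area_measure_def)
  then have sets: "sets ?P = sets borel"
    unfolding borel_prod .
  have [measurable]: "(\<lambda>(t, I). qcis t I) \<in> borel_measurable ?P"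
    using borel_measurable_qcis by (simp add: measurable_cong_sets[OF sets refl])
  have U: "UNIV \<in> sets ?U" "UNIV \<in> sets area_measure"
    by (simp_all add: area_measure_def)
  have P: "emeasure ?P (UNIV \<times> \<SS>) = 1" "emeasure ?P (UNIV \<times> UNIV) = 1"
    using A.emeasure_pair_measure_Times[OF U(1) S] A.emeasure_pair_measure_Times[OF U]
    by (simp_all only: U1 emeasure_area_measure_imag_units emeasure_area_measure_UNIV mult_1)
  have "emeasure bdry_measure UNIV = emeasure ?P ((\<lambda>(t, I). qcis t I) -` UNIV \<inter> space ?P)"
    unfolding bdry_measure_def by (rule emeasure_distr) simp_all
  then show UN: "emeasure bdry_measure UNIV = 1"
    using P(2) by (simp add: sp)
  have "1 = emeasure ?P (UNIV \<times> \<SS>)"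
    using P by simp
  also have "\<dots> \<le> emeasure ?P ((\<lambda>(t, I). qcis t I) -` \<partial>\<BB> \<inter> space ?P)"
    using B by (intro emeasure_mono measurable_sets) (auto simp: sp bdry_ball_def)
  also have "\<dots> = emeasure bdry_measure \<partial>\<BB>"
    unfolding bdry_measure_def using B by (intro emeasure_distr[symmetric]) simp_all
  finally have "1 \<le> emeasure bdry_measure \<partial>\<BB>" .
  moreover have "emeasure bdry_measure \<partial>\<BB> \<le> emeasure bdry_measure UNIV"
    by (intro emeasure_mono) (simp_all add: bdry_measure_def)
  ultimately show "emeasure bdry_measure \<partial>\<BB> = 1"
    using UN by simp
qed

lemma slice_function_affine:
  assumes "slice_function f"
  obtains \<alpha> \<beta> where "\<And>I. I \<in> \<SS> \<Longrightarrow> f (qcis t I) = \<alpha> + I * \<beta>"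
proof -
  define J where "J = Quat 0 1 0 0"
  define K where "K = Quat 0 0 1 0"
  have JK: "J \<in> \<SS>" "K \<in> \<SS>" "J \<noteq> K"
    by (simp_all add: J_def K_def imag_units_iff)
  define \<alpha> where "\<alpha> = inverse (J - K) * J * f (qcis t J) - inverse (J - K) * K * f (qcis t K)"
  define \<beta> where "\<beta> = inverse (J - K) * f (qcis t J) - inverse (J - K) * f (qcis t K)"
  have "f (qcis t I) = \<alpha> + I * \<beta>" if I: "I \<in> \<SS>" for I
  proof -
    have "qcis t I \<in> \<partial>\<BB>"
      using I by (auto simp: bdry_ball_def)
    then have "f (qcis t I) =
        (inverse (J - K) * J + I * inverse (J - K)) * f (qcis t J)
        - (inverse (J - K) * K + I * inverse (J - K)) * f (qcis t K)"
      using assms JK I unfolding slice_function_def qcis_def by blast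
    then show ?thesis
      by (simp add: \<alpha>_def \<beta>_def algebra_simps)
  qed
  then show ?thesis
    using that by blast
qed

lemma slice_conj_qcis:
  assumes f: "\<And>I'. I' \<in> \<SS> \<Longrightarrow> f (qcis t I') = \<alpha> + I' * \<beta>" and I: "I \<in> \<SS>"
  shows "slice_conj f (qcis t I) = qcnj \<alpha> + I * qcnj \<beta>"
  unfolding slice_conj_def
proof (rule the_equality)
  show "\<exists>t' I'' \<alpha>' \<beta>'. I'' \<in> \<SS> \<and> qcis t I = qcis t' I'' \<and>
      (\<forall>I'\<in>\<SS>. f (qcis t' I') = \<alpha>' + I' * \<beta>') \<and> qcnj \<alpha> + I * qcnj \<beta> = qcnj \<alpha>' + I'' * qcnj \<beta>'"
    by (rule exI[of _ t], rule exI[of _ I], rule exI[of _ \<alpha>], rule exI[of _ \<beta>])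
      (simp add: f I)
next
  fix p
  assume "\<exists>t' I'' \<alpha>' \<beta>'. I'' \<in> \<SS> \<and> qcis t I = qcis t' I'' \<and>
      (\<forall>I'\<in>\<SS>. f (qcis t' I') = \<alpha>' + I' * \<beta>') \<and> p = qcnj \<alpha>' + I'' * qcnj \<beta>'"
  then obtain t' I'' \<alpha>' \<beta>' where h: "I'' \<in> \<SS>" "qcis t I = qcis t' I''"
    "\<And>I'. I' \<in> \<SS> \<Longrightarrow> f (qcis t' I') = \<alpha>' + I' * \<beta>'" "p = qcnj \<alpha>' + I'' * qcnj \<beta>'"
    by blast
  have cs: "cos t = cos t'" "of_real (sin t) * I = of_real (sin t') * I''"
  proof -
    have r: "qRe I = 0" "qRe I'' = 0"
      using I h(1) by (simp_all add: imag_units_iff)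
    have "qRe (qcis t I) = cos t" "qRe (qcis t' I'') = cos t'"
      by (simp_all add: qcis_def quat_sel_times r)
    then show "cos t = cos t'"
      using h(2) by simp
    then show "of_real (sin t) * I = of_real (sin t') * I''"
      using h(2) by (simp add: qcis_def)
  qed
  have inj: "a = a' \<and> b = b'" if "\<And>J. J \<in> \<SS> \<Longrightarrow> a + J * b = a' + J * b'" for a b a' b' :: quat
  proof -
    define J where "J = Quat 0 1 0 0"
    have J: "J \<in> \<SS>"
      by (simp add: J_def imag_units_iff)
    have "a + J * b = a' + J * b'" "a - J * b = a' - J * b'"
      using that[OF J] that[OF imag_units_uminus[OF J]] by simp_all
    then have "(a + J * b) + (a - J * b) = (a' + J * b') + (a' - J * b')"
      by (simp only:)
    then have "2 *\<^sub>R a = 2 *\<^sub>R a'"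
      by (simp add: scaleR_2)
    then have "a = a'" by simp
    moreover have "J \<noteq> 0" by (simp add: J_def quat_eq_iff)
    ultimately show ?thesis
      using that[OF J] by simp
  qed
  consider "sin t = 0" "sin t' = 0" | "sin t \<noteq> 0" "sin t' = sin t" | "sin t \<noteq> 0" "sin t' = - sin t"
  proof -
    have "(sin t')\<^sup>2 = (sin t)\<^sup>2"
      by (simp only: sin_squared_eq cs(1))
    then have "sin t' = sin t \<or> sin t' = - sin t"
      by (simp add: power2_eq_iff)
    then have "sin t = 0 \<and> sin t' = 0 \<or> sin t \<noteq> 0 \<and> sin t' = sin t \<or> sin t \<noteq> 0 \<and> sin t' = - sin t"
      by (metis neg_equal_0_iff_equal)
    then show ?thesis
      using that by blast
  qed
  then show "p = qcnj \<alpha> + I * qcnj \<beta>"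
  proof cases
    case 1
    then have q: "qcis t I' = qcis t I" "qcis t' I' = qcis t I" for I'
      using cs by (simp_all add: qcis_def)
    have "\<alpha> + J * \<beta> = f (qcis t I) + J * 0" if "J \<in> \<SS>" for J
      using f[OF that] by (simp only: q(1)[of J] mult_zero_right add_0_right)
    then have "\<alpha> = f (qcis t I) \<and> \<beta> = 0"
      by (rule inj)
    moreover have "\<alpha>' + J * \<beta>' = f (qcis t I) + J * 0" if "J \<in> \<SS>" for J
      using h(3)[OF that] by (simp only: q(2)[of J] mult_zero_right add_0_right)
    then have "\<alpha>' = f (qcis t I) \<and> \<beta>' = 0"
      by (rule inj)
    ultimately show ?thesis
      by (simp add: h(4))
  next
    case 2
    then have q: "qcis t' I' = qcis t I'" for I'
      using cs by (simp add: qcis_def)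
    have "\<alpha> + J * \<beta> = \<alpha>' + J * \<beta>'" if "J \<in> \<SS>" for J
      using f[OF that] h(3)[OF that] by (simp add: q)
    then have "\<alpha> = \<alpha>' \<and> \<beta> = \<beta>'"
      by (rule inj)
    moreover have "I'' = I"
      using 2 cs by simp
    ultimately show ?thesis
      by (simp add: h(4))
  next
    case 3
    then have q: "qcis t' I' = qcis t (- I')" for I'
      using cs by (simp add: qcis_def)
    have "\<alpha> + J * (- \<beta>) = \<alpha>' + J * \<beta>'" if "J \<in> \<SS>" for J
      using f[OF imag_units_uminus[OF that]] h(3)[OF that] by (simp add: q)
    then have "\<alpha> = \<alpha>' \<and> - \<beta> = \<beta>'"
      by (rule inj)
    moreover have "I'' = - I"
    proof -
      have "of_real (sin t) * I = of_real (sin t) * (- I'')"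
        using 3 cs(2) by simp
      then have "I = - I''"
        using 3(1) by (simp only: mult_cancel_left of_real_eq_0_iff) simp
      then show ?thesis by simp
    qed
    ultimately have "I'' = - I" "\<alpha>' = \<alpha>" "\<beta>' = - \<beta>"
      by simp_all
    then show ?thesis
      by (simp add: h(4))
  qed
qed

end

theory Submission
  imports Defs
begin

text \<open>
  On a sphere \<open>e\<^sup>t\<^sup>\<SS>\<close> a slice function is affine, \<open>f (e\<^sup>t\<^sup>I) = \<alpha> + I \<beta>\<close> with constants \<open>\<alpha>\<close> and \<open>\<beta>\<close>,
  so everything reduces to algebra in the two quaternions \<open>\<alpha>\<close> and \<open>\<beta>\<close>.  The conjugation in the
  \<open>*\<close>-product turns \<open>I\<close> into \<open>w\<^sup>-\<^sup>1 I w\<close> with \<open>w = \<alpha> + I \<beta>\<close>, and multiplying by \<open>w\<close> from the left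
  removes the inverse: \<open>f * f\<close> is again affine, with the coefficients of \<open>(\<alpha> + i \<beta>)\<^sup>2\<close> for a formal
  imaginary unit \<open>i\<close> that commutes with the quaternions.  Hence \<open>f * f = f\<close> says that
  \<open>\<alpha>\<^sup>2 - \<beta>\<^sup>2 = \<alpha>\<close> and \<open>\<alpha> \<beta> + \<beta> \<alpha> = \<beta>\<close>, that is, \<open>\<alpha> + i \<beta>\<close> is an idempotent of the complexified
  quaternions.

  If \<open>\<beta> = 0\<close>, then \<open>\<alpha>\<close> is an idempotent of a skew field, so it is \<open>0\<close> or \<open>1\<close>.  If \<open>\<beta> \<noteq> 0\<close>, the affine
  function \<open>I \<mapsto> \<alpha> + I \<beta>\<close> takes the value \<open>0\<close> at \<open>I = - \<alpha> \<beta>\<^sup>-\<^sup>1\<close> and the value \<open>1\<close> at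
  \<open>I = (1 - \<alpha>) \<beta>\<^sup>-\<^sup>1\<close>.  These are the \<open>J\<close> and \<open>K\<close> of the theorem: the two equations for
  \<open>\<alpha>\<close> and \<open>\<beta>\<close> make both of them square roots of \<open>-1\<close>, and an affine function is determined by
  its values at two points (lemma \<open>idempotent_coefficients\<close>).

  Passing from \<open>f\<close> to the conjugate of \<open>q \<mapsto> f (qcnj q)\<close> changes the coefficients to
  \<open>qcnj \<alpha>\<close> and \<open>- qcnj \<beta>\<close>, so invariance of \<open>f\<close> forces \<open>\<alpha>\<close> to be real.  Since
  \<open>\<alpha> = - (J - K)\<^sup>-\<^sup>1 K\<close>, the unit vectors \<open>J\<close> and \<open>K\<close> are then parallel, and being distinct
  they are opposite.
\<close>

section \<open>Imaginary units\<close>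

lemma imag_units_norm:
  assumes "I \<in> \<SS>"
  shows "norm I = 1"
  using assms by (simp add: imag_units_iff norm_quat_def)

lemma imag_units_conjugate:
  assumes "I \<in> \<SS>" and "w \<noteq> 0"
  shows "inverse w * I * w \<in> \<SS>"
proof -
  have "(inverse w * I * w)\<^sup>2 = inverse w * I * (w * inverse w) * I * w"
    by (simp only: power2_eq_square mult.assoc)
  also have "\<dots> = inverse w * I\<^sup>2 * w"
    using assms(2) by (simp add: power2_eq_square mult.assoc)
  finally show ?thesis
    using assms by (simp add: imag_units_def)
qed

lemma of_real_quat_commute: "of_real r * (q :: quat) = q * of_real r"
  by (simp add: quat_eq_iff quat_sel_times)

lemma qcis_conjugate:
  assumes "w \<noteq> 0"
  shows "inverse w * qcis t I * w = qcis t (inverse w * I * w)"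
proof -
  have "inverse w * of_real r * q = of_real r * (inverse w * q)" for r q
    by (simp only: of_real_quat_commute[symmetric] mult.assoc)
  then show ?thesis
    using assms by (simp add: qcis_def distrib_left distrib_right mult.assoc[symmetric])
      (simp add: mult.assoc of_real_quat_commute[symmetric])
qed

lemma qcnj_qcis:
  assumes "I \<in> \<SS>"
  shows "qcnj (qcis t I) = qcis t (- I)"
  using assms by (simp add: qcis_def quat_eq_iff quat_sel_times imag_units_iff)

section \<open>Affine functions on the sphere of imaginary units\<close>

text \<open>
  The values at \<open>I\<close> and \<open>- I\<close> already determine both coefficients: their sum is \<open>2 \<alpha>\<close>.
\<close>

lemma affine_on_imag_units_unique:
  fixes \<alpha> \<beta> \<alpha>' \<beta>' :: quat
  assumes "\<And>I. I \<in> \<SS> \<Longrightarrow> \<alpha> + I * \<beta> = \<alpha>' + I * \<beta>'"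
  shows "\<alpha> = \<alpha>'" and "\<beta> = \<beta>'"
proof -
  obtain J where J: "J \<in> \<SS>"
    by (metis spherical_in_imag_units)
  have plus: "\<alpha> + J * \<beta> = \<alpha>' + J * \<beta>'" and minus: "\<alpha> - J * \<beta> = \<alpha>' - J * \<beta>'"
    using assms[OF J] assms[OF imag_units_uminus[OF J]] by simp_all
  have "2 *\<^sub>R \<alpha> = (\<alpha> + J * \<beta>) + (\<alpha> - J * \<beta>)"
    by (simp add: scaleR_2)
  also have "\<dots> = 2 *\<^sub>R \<alpha>'"
    unfolding plus minus by (simp add: scaleR_2)
  finally show \<alpha>: "\<alpha> = \<alpha>'"
    by simp
  have "J \<noteq> 0"
    using imag_units_norm[OF J] by auto
  then show "\<beta> = \<beta>'"
    using plus \<alpha> by simp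
qed

text \<open>
  With \<open>w = f (q)\<close>, the product is \<open>w (\<gamma> + w\<^sup>-\<^sup>1 I w \<delta>) = w \<gamma> + I w \<delta>\<close>.  The last expression
  vanishes for \<open>w = 0\<close>, so it also covers the exceptional value in the definition of the
  \<open>*\<close>-product; it is affine in \<open>I\<close> because \<open>I\<^sup>2 = -1\<close>.
\<close>

lemma star_prod_affine:
  assumes f: "\<And>I. I \<in> \<SS> \<Longrightarrow> f (qcis t I) = \<alpha> + I * \<beta>"
    and g: "\<And>I. I \<in> \<SS> \<Longrightarrow> g (qcis t I) = \<gamma> + I * \<delta>"
    and I: "I \<in> \<SS>"
  shows "(f \<star> g) (qcis t I) = (\<alpha> * \<gamma> - \<beta> * \<delta>) + I * (\<alpha> * \<delta> + \<beta> * \<gamma>)"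
proof -
  define w where "w = \<alpha> + I * \<beta>"
  have fw: "f (qcis t I) = w"
    using f[OF I] by (simp add: w_def)
  have "(f \<star> g) (qcis t I) = w * \<gamma> + I * w * \<delta>"
  proof (cases "w = 0")
    case True
    then show ?thesis
      by (simp add: star_prod_def fw)
  next
    case False
    have "(f \<star> g) (qcis t I) = w * (\<gamma> + inverse w * I * w * \<delta>)"
      using False g[OF imag_units_conjugate[OF I False]]
      by (simp add: star_prod_def fw qcis_conjugate)
    also have "\<dots> = w * \<gamma> + (w * inverse w) * I * w * \<delta>"
      by (simp only: distrib_left mult.assoc)
    finally show ?thesis
      using False by simp
  qed
  also have "\<dots> = \<alpha> * \<gamma> + (I * I) * \<beta> * \<delta> + I * (\<alpha> * \<delta> + \<beta> * \<gamma>)"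
    by (simp add: w_def algebra_simps)
  also have "I * I = -1"
    using I by (simp add: imag_units_def power2_eq_square)
  finally show ?thesis
    by simp
qed

section \<open>Idempotent coefficients\<close>

text \<open>
  The equation \<open>\<alpha> \<beta> + \<beta> \<alpha> = \<beta>\<close> means that conjugation by \<open>\<beta>\<close> exchanges \<open>\<alpha>\<close> and \<open>1 - \<alpha>\<close>.  Moving
  \<open>\<beta>\<^sup>-\<^sup>1\<close> past \<open>\<alpha>\<close> in this way gives \<open>K = \<beta>\<^sup>-\<^sup>1 \<alpha>\<close>, \<open>K\<^sup>2 = \<beta>\<^sup>-\<^sup>2 (1 - \<alpha>) \<alpha>\<close>, and the other equation
  says that \<open>(1 - \<alpha>) \<alpha> = - \<beta>\<^sup>2\<close>.  The computation for \<open>J\<close> is the same with \<open>\<alpha> - 1\<close> in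
  place of \<open>\<alpha>\<close>.
\<close>

lemma idempotent_coefficients:
  fixes \<alpha> \<beta> :: quat
  assumes real_part: "\<alpha> * \<alpha> - \<beta> * \<beta> = \<alpha>"
    and imag_part: "\<alpha> * \<beta> + \<beta> * \<alpha> = \<beta>"
    and \<beta>: "\<beta> \<noteq> 0"
  obtains J K where "J \<in> \<SS>" "K \<in> \<SS>" "J \<noteq> K"
    "\<alpha> = - (inverse (J - K) * K)" "\<beta> = - inverse (J - K)"
proof -
  define b where "b = inverse \<beta>"
  have b: "b * \<beta> = 1" "\<beta> * b = 1"
    using \<beta> by (simp_all add: b_def)
  have swap: "\<alpha> * b = b * (1 - \<alpha>)"
  proof -
    have "\<beta> * \<alpha> = \<beta> - \<alpha> * \<beta>"
      using imag_part by (simp add: eq_diff_eq add.commute)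
    then have "\<beta> * (\<alpha> * b) = (\<beta> - \<alpha> * \<beta>) * b"
      by (simp only: mult.assoc[symmetric])
    also have "\<dots> = 1 - \<alpha> * (\<beta> * b)"
      by (simp add: left_diff_distrib b mult.assoc)
    finally have "\<beta> * (\<alpha> * b) = 1 - \<alpha>"
      by (simp add: b)
    then have "b * \<beta> * (\<alpha> * b) = b * (1 - \<alpha>)"
      by (simp only: mult.assoc)
    then show ?thesis
      by (simp only: b mult_1)
  qed
  have sq: "b * (b * (\<beta> * \<beta>)) = 1"
    by (simp add: b mult.assoc[symmetric])
  have prod: "(1 - \<alpha>) * \<alpha> = - (\<beta> * \<beta>)" "\<alpha> * (\<alpha> - 1) = \<beta> * \<beta>"
    using real_part by (simp_all add: algebra_simps)
  define J where "J = b * (\<alpha> - 1)"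
  define K where "K = b * \<alpha>"
  have "K * K = b * (\<alpha> * b) * \<alpha>"
    by (simp add: K_def mult.assoc)
  also have "\<dots> = b * (b * ((1 - \<alpha>) * \<alpha>))"
    by (simp only: swap mult.assoc)
  also have "\<dots> = - 1"
    by (simp add: prod sq)
  finally have K: "K \<in> \<SS>"
    by (simp add: imag_units_def power2_eq_square)
  have "J * J = b * (\<alpha> * b - b) * (\<alpha> - 1)"
    by (simp add: J_def algebra_simps)
  also have "\<alpha> * b - b = - (b * \<alpha>)"
    by (simp add: swap algebra_simps)
  also have "b * - (b * \<alpha>) * (\<alpha> - 1) = - (b * (b * (\<alpha> * (\<alpha> - 1))))"
    by (simp only: mult.assoc mult_minus_left mult_minus_right)
  also have "\<dots> = - 1"
    by (simp add: prod sq)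
  finally have J: "J \<in> \<SS>"
    by (simp add: imag_units_def power2_eq_square)
  have diff: "J - K = - b"
    by (simp add: J_def K_def algebra_simps)
  have inv: "inverse (J - K) = - \<beta>"
    by (simp add: diff b_def)
  show ?thesis
  proof (rule that[OF J K])
    show "J \<noteq> K"
      using diff \<beta> by (auto simp: b_def)
    show "\<alpha> = - (inverse (J - K) * K)"
      unfolding inv by (simp add: K_def b mult.assoc[symmetric])
    show "\<beta> = - inverse (J - K)"
      by (simp add: inv)
  qed
qed

text \<open>
  If \<open>- (J - K)\<^sup>-\<^sup>1 K\<close> is a real number \<open>r\<close>, then \<open>K = - r (J - K)\<close>, or \<open>r J = (r - 1) K\<close>.  As \<open>J\<close> and
  \<open>K\<close> have norm \<open>1\<close>, this gives \<open>\<bar>r\<bar> = \<bar>r - 1\<bar>\<close>, hence \<open>r = 1/2\<close>.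
\<close>

lemma opposite_if_real_coefficient:
  fixes J K :: quat
  assumes "J \<in> \<SS>" "K \<in> \<SS>" "J \<noteq> K" "- (inverse (J - K) * K) = of_real r"
  shows "K = - J"
proof -
  have "K = (J - K) * (inverse (J - K) * K)"
    using assms(3) by (simp add: mult.assoc[symmetric])
  also have "inverse (J - K) * K = - of_real r"
    using assms(4) by (metis minus_minus)
  finally have "K = - (r *\<^sub>R (J - K))"
    by (simp add: scaleR_conv_of_real of_real_quat_commute)
  then have par: "r *\<^sub>R J = (r - 1) *\<^sub>R K"
    by (simp add: algebra_simps)
  then have "norm (r *\<^sub>R J) = norm ((r - 1) *\<^sub>R K)"
    by simp
  then have "\<bar>r\<bar> = \<bar>r - 1\<bar>"
    using assms(1,2) by (simp add: imag_units_norm)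
  then have "r = 1/2"
    by linarith
  with par have "(1/2) *\<^sub>R J = (1/2) *\<^sub>R (- K)"
    by simp
  then have "J = - K"
    by (simp only: scaleR_cancel_left) simp
  then show ?thesis
    by simp
qed

section \<open>Idempotent slice functions\<close>

theorem theorem1p2:
  fixes f :: "quat \<Rightarrow> quat"
  assumes L2: "f \<in> L2_slice"
    and idem: "\<forall>q\<in>\<partial>\<BB>. (f \<star> f) q = f q"
  shows "(\<forall>t::real.
            (\<forall>I\<in>\<SS>. f (qcis t I) = 0) \<or>
            (\<forall>I\<in>\<SS>. f (qcis t I) = 1) \<or>
            (\<exists>J\<in>\<SS>. \<exists>K\<in>\<SS>. J \<noteq> K \<and>
              (\<forall>I\<in>\<SS>. f (qcis t I) = - (inverse (J - K) * K + I * inverse (J - K))))) \<and>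
         ((\<forall>q\<in>\<partial>\<BB>. slice_conj (tilde f) q = f q) \<longrightarrow>
          (\<forall>t::real. \<forall>J\<in>\<SS>. \<forall>K\<in>\<SS>. J \<noteq> K \<longrightarrow>
            (\<forall>I\<in>\<SS>. f (qcis t I) = - (inverse (J - K) * K + I * inverse (J - K))) \<longrightarrow>
            K = - J))"
proof (intro conjI allI impI ballI)
  fix t :: real
  have "slice_function f"
    using L2 by (simp add: L2_slice_def)
  then obtain \<alpha> \<beta> where f: "\<And>I. I \<in> \<SS> \<Longrightarrow> f (qcis t I) = \<alpha> + I * \<beta>"
    using slice_function_affine[of f t] by blast
  have eq: "(\<alpha> * \<alpha> - \<beta> * \<beta>) + I * (\<alpha> * \<beta> + \<beta> * \<alpha>) = \<alpha> + I * \<beta>" if I: "I \<in> \<SS>" for I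
  proof -
    have "qcis t I \<in> \<partial>\<BB>"
      using I by (auto simp: bdry_ball_def)
    with idem have "(f \<star> f) (qcis t I) = f (qcis t I)"
      by blast
    then show ?thesis
      using star_prod_affine[OF f f I] f[OF I] by simp
  qed
  note coeffs = affine_on_imag_units_unique[OF eq]
  show "(\<forall>I\<in>\<SS>. f (qcis t I) = 0) \<or> (\<forall>I\<in>\<SS>. f (qcis t I) = 1) \<or>
      (\<exists>J\<in>\<SS>. \<exists>K\<in>\<SS>. J \<noteq> K \<and>
        (\<forall>I\<in>\<SS>. f (qcis t I) = - (inverse (J - K) * K + I * inverse (J - K))))"
  proof (cases "\<beta> = 0")
    case True
    then have "\<alpha> * \<alpha> = \<alpha>"
      using coeffs(1) by simp
    then have "\<alpha> = 0 \<or> \<alpha> = 1"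
      by simp
    then show ?thesis
      using f True by auto
  next
    case False
    obtain J K where JK: "J \<in> \<SS>" "K \<in> \<SS>" "J \<noteq> K"
      "\<alpha> = - (inverse (J - K) * K)" "\<beta> = - inverse (J - K)"
      using idempotent_coefficients[OF coeffs False] by blast
    have "f (qcis t I) = - (inverse (J - K) * K + I * inverse (J - K))" if "I \<in> \<SS>" for I
      using f[OF that] by (simp add: JK(4,5))
    then show ?thesis
      using JK(1-3) by blast
  qed
next
  fix t J K
  assume sym: "\<forall>q\<in>\<partial>\<BB>. slice_conj (tilde f) q = f q"
    and JK: "J \<in> \<SS>" "K \<in> \<SS>" "J \<noteq> K"
    and fJK: "\<forall>I\<in>\<SS>. f (qcis t I) = - (inverse (J - K) * K + I * inverse (J - K))"
  define \<alpha> where "\<alpha> = - (inverse (J - K) * K)"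
  define \<beta> where "\<beta> = - inverse (J - K)"
  have f: "f (qcis t I) = \<alpha> + I * \<beta>" if "I \<in> \<SS>" for I
    using fJK that by (simp add: \<alpha>_def \<beta>_def)
  have tilde: "tilde f (qcis t I) = \<alpha> + I * (- \<beta>)" if "I \<in> \<SS>" for I
    using f[OF imag_units_uminus[OF that]] by (simp add: tilde_def qcnj_qcis that)
  have "qcnj \<alpha> + I * qcnj (- \<beta>) = \<alpha> + I * \<beta>" if I: "I \<in> \<SS>" for I
  proof -
    have "qcis t I \<in> \<partial>\<BB>"
      using I by (auto simp: bdry_ball_def)
    with sym have "slice_conj (tilde f) (qcis t I) = f (qcis t I)"
      by blast
    then show ?thesis
      using slice_conj_qcis[OF tilde I] f[OF I] by simp
  qed
  then have "qcnj \<alpha> = \<alpha>"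
    by (rule affine_on_imag_units_unique(1))
  then have "\<alpha> = of_real (qRe \<alpha>)"
    by (simp add: quat_eq_iff)
  then show "K = - J"
    using opposite_if_real_coefficient[OF JK] by (simp only: \<alpha>_def)
qed

end
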